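(* In the planar Newtonian four-body problem there exist non-symmetric trapezoid central configurations with positive masses in which two of the masses are equal.
   Context: A configuration $(q_1,\dots,q_4)$ of pairwise distinct points of $\mathbb{R}^2$ with positive masses $m_1,\dots,m_4$ is a central configuration if there is $\lambda>0$ with $\sum_{j\ne k} m_j\,(q_j-q_k)/\|q_j-q_k\|^3=-\lambda\,(q_k-\mathbf{c})$ for all $k$, where $\mathbf{c}=\sum m_kq_k/\sum m_k$. It is a trapezoid central configuration if the four points are the vertices of a trapezoid, i.e. a (non-degenerate) convex quadrilateral with at least one pair of parallel sides. It is non-symmetric if this quadrilateral has no axis of symmetry and is not a parallelogram (in particular, it is neither a rhombus nor an isosceles trapezoid). *)

theory Defs
  imports "HOL-Analysis.Analysis"
begin

definition center_of_mass :: "('n::finite \<Rightarrow> real) \<Rightarrow> ('n \<Rightarrow> 'a::real_vector) \<Rightarrow> 'a" where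
  "center_of_mass m q = (\<Sum>k\<in>UNIV. m k *\<^sub>R q k) /\<^sub>R (\<Sum>k\<in>UNIV. m k)"

definition central_configuration ::
    "('n::finite \<Rightarrow> real) \<Rightarrow> ('n \<Rightarrow> 'a::euclidean_space) \<Rightarrow> bool" where
  "central_configuration m q \<longleftrightarrow>
     inj q \<and> (\<forall>k. 0 < m k) \<and>
     (\<exists>l>0. \<forall>k. (\<Sum>j\<in>UNIV - {k}. (m j / norm (q j - q k) ^ 3) *\<^sub>R (q j - q k))
                   = - (l *\<^sub>R (q k - center_of_mass m q)))"

text \<open>The points \<open>a, b, c, d\<close> are listed in cyclic order: they are the vertices of the
  convex polygon they span, and its sides are \<open>ab, bc, cd, da\<close>. In the plane, four distinct
  extreme points exclude all degenerate cases, since no three of them can be collinear.\<close>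

definition convex_quadrilateral ::
    "real^2 \<Rightarrow> real^2 \<Rightarrow> real^2 \<Rightarrow> real^2 \<Rightarrow> bool" where
  "convex_quadrilateral a b c d \<longleftrightarrow>
     distinct [a, b, c, d] \<and>
     (let Q = convex hull {a, b, c, d} in
        (\<forall>v\<in>{a, b, c, d}. v extreme_point_of Q) \<and>
        closed_segment a b edge_of Q \<and> closed_segment b c edge_of Q \<and>
        closed_segment c d edge_of Q \<and> closed_segment d a edge_of Q)"

definition parallel_sides :: "real^2 \<Rightarrow> real^2 \<Rightarrow> real^2 \<Rightarrow> real^2 \<Rightarrow> bool" where
  "parallel_sides a b c d \<longleftrightarrow> collinear {0, b - a, d - c}"

text \<open>A quadrilateral is given by its vertex set \<open>V\<close>.\<close>

definition trapezoid :: "(real^2) set \<Rightarrow> bool" where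
  "trapezoid V \<longleftrightarrow>
     (\<exists>a b c d. V = {a, b, c, d} \<and> convex_quadrilateral a b c d \<and>
        (parallel_sides a b c d \<or> parallel_sides b c d a))"

definition parallelogram :: "(real^2) set \<Rightarrow> bool" where
  "parallelogram V \<longleftrightarrow>
     (\<exists>a b c d. V = {a, b, c, d} \<and> convex_quadrilateral a b c d \<and>
        parallel_sides a b c d \<and> parallel_sides b c d a)"

text \<open>Reflection in the line through \<open>p\<close> with direction \<open>u\<close>, for a unit vector \<open>u\<close>.\<close>

definition line_reflection :: "real^2 \<Rightarrow> real^2 \<Rightarrow> real^2 \<Rightarrow> real^2" where
  "line_reflection p u x = p + (2 * ((x - p) \<bullet> u)) *\<^sub>R u - (x - p)"

definition has_symmetry_axis :: "(real^2) set \<Rightarrow> bool" where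
  "has_symmetry_axis S \<longleftrightarrow> (\<exists>p u. norm u = 1 \<and> line_reflection p u ` S = S)"

definition trapezoid_central_configuration :: "(4 \<Rightarrow> real) \<Rightarrow> (4 \<Rightarrow> real^2) \<Rightarrow> bool" where
  "trapezoid_central_configuration m q \<longleftrightarrow> central_configuration m q \<and> trapezoid (range q)"

definition non_symmetric :: "(4 \<Rightarrow> real^2) \<Rightarrow> bool" where
  "non_symmetric q \<longleftrightarrow>
     \<not> has_symmetry_axis (convex hull range q) \<and> \<not> parallelogram (range q)"

end

theory Submission
  imports Defs
begin

text \<open>Put the bases of the trapezoid on two horizontal lines,
  \<open>q\<^sub>1 = (0,0)\<close>, \<open>q\<^sub>2 = (a,0)\<close>, \<open>q\<^sub>3 = (x+b,h)\<close>, \<open>q\<^sub>4 = (x,h)\<close>. The affine relation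
  between the vertices has coefficients \<open>D = (b,-b,a,-a)\<close>, so by Dziobek's equations the
  configuration is central as soon as \<open>m\<^sub>i m\<^sub>j S\<^sub>i\<^sub>j = \<kappa> D\<^sub>i D\<^sub>j\<close>, where
  \<open>S\<^sub>i\<^sub>j = r\<^sub>i\<^sub>j\<^sup>-\<^sup>3 - 1\<close>. The choice \<open>m\<^sub>1 = m\<^sub>4\<close> turns these into
  \<open>a S\<^sub>1\<^sub>3 = - b S\<^sub>3\<^sub>4\<close>, \<open>b S\<^sub>2\<^sub>4 = - a S\<^sub>1\<^sub>2\<close> and \<open>S\<^sub>1\<^sub>2 S\<^sub>3\<^sub>4 = S\<^sub>1\<^sub>4 S\<^sub>2\<^sub>3\<close>. The first two
  give the diagonals, hence the whole trapezoid, in terms of the bases. For \<open>a = 9/10\<close> the third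
  one is solved by the intermediate value theorem for some \<open>b\<close> between \<open>17/20\<close> and \<open>87/100\<close>.\<close>

section \<open>Dziobek's equations\<close>

text \<open>Dividing \<open>dz\<close> by the mass of body \<open>k\<close> splits the coefficient
  of \<open>q j - q k\<close> into \<open>s * m j\<close> and a multiple of \<open>D j\<close>. The
  first part sums to the central force; the second sums to zero since \<open>D\<close> is an affine
  relation. So the multiplier is \<open>s\<close> times the total mass.\<close>

lemma central_configurationI_Dziobek:
  fixes q :: "'n::finite \<Rightarrow> 'a::euclidean_space"
  assumes inj: "inj q" and pos: "\<And>k. 0 < m k" and s: "0 < s"
    and D0: "(\<Sum>k\<in>UNIV. D k) = 0" and Dq: "(\<Sum>k\<in>UNIV. D k *\<^sub>R q k) = 0"
    and dz: "\<And>i j. i \<noteq> j \<Longrightarrow> m i * m j * (1 / norm (q i - q j) ^ 3 - s) = \<kappa> * D i * D j"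
  shows "central_configuration m q"
proof -
  define M where "M = (\<Sum>k\<in>UNIV. m k)"
  have M: "0 < M" unfolding M_def by (rule sum_pos) (auto simp: pos)
  have eq: "(\<Sum>j\<in>UNIV - {k}. (m j / norm (q j - q k) ^ 3) *\<^sub>R (q j - q k))
              = - ((s * M) *\<^sub>R (q k - center_of_mass m q))" for k
  proof -
    have "(\<Sum>j\<in>UNIV - {k}. (m j / norm (q j - q k) ^ 3) *\<^sub>R (q j - q k))
        = (\<Sum>j\<in>UNIV - {k}. (s * m j + \<kappa> * D k / m k * D j) *\<^sub>R (q j - q k))"
    proof (rule sum.cong[OF refl])
      fix j assume "j \<in> UNIV - {k}"
      then have "m k * m j * (1 / norm (q j - q k) ^ 3 - s) = \<kappa> * D k * D j"
        using dz[of j k] by (simp add: mult_ac)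
      then have "m j / norm (q j - q k) ^ 3 = s * m j + \<kappa> * D k / m k * D j"
        using pos[of k] by (simp add: field_simps)
      then show "(m j / norm (q j - q k) ^ 3) *\<^sub>R (q j - q k)
          = (s * m j + \<kappa> * D k / m k * D j) *\<^sub>R (q j - q k)" by simp
    qed
    also have "\<dots> = (\<Sum>j\<in>UNIV. (s * m j + \<kappa> * D k / m k * D j) *\<^sub>R (q j - q k))"
      by (rule sum.mono_neutral_left) auto
    also have "\<dots> = s *\<^sub>R (\<Sum>j\<in>UNIV. m j *\<^sub>R q j) - (s * M) *\<^sub>R q k
        + (\<kappa> * D k / m k) *\<^sub>R ((\<Sum>j\<in>UNIV. D j *\<^sub>R q j) - (\<Sum>j\<in>UNIV. D j) *\<^sub>R q k)"
      by (simp add: M_def scaleR_sum_right scaleR_sum_left sum_distrib_left algebra_simps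
          sum.distrib sum_subtractf)
    also have "\<dots> = - ((s * M) *\<^sub>R (q k - center_of_mass m q))"
      using M by (simp add: D0 Dq center_of_mass_def M_def[symmetric] algebra_simps)
    finally show ?thesis .
  qed
  then show ?thesis
    unfolding central_configuration_def using inj pos mult_pos_pos[OF s M] by blast
qed

section \<open>Axes of symmetry\<close>

lemma dist_line_reflection:
  assumes "norm u = 1"
  shows "dist (line_reflection p u x) (line_reflection p u y) = dist x y"
proof -
  define z where "z = x - y"
  have uu: "u \<bullet> u = 1" using assms by (simp add: dot_square_norm)
  have "line_reflection p u x - line_reflection p u y = (2 * (z \<bullet> u)) *\<^sub>R u - z"
    by (simp add: line_reflection_def z_def algebra_simps)
  moreover have "(norm ((2 * (z \<bullet> u)) *\<^sub>R u - z))\<^sup>2 = (norm z)\<^sup>2"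
    unfolding power2_norm_eq_inner
    by (simp add: inner_diff_left inner_diff_right uu inner_commute[of u z])
  ultimately show ?thesis by (simp add: dist_norm z_def)
qed

lemma convex_hull_line_reflection:
  "convex hull (line_reflection p u ` V) = line_reflection p u ` (convex hull V)"
proof -
  define L where "L = (\<lambda>x::real^2. (2 * (x \<bullet> u)) *\<^sub>R u - x)"
  have "linear L" unfolding L_def
    by (intro linearI) (simp_all add: algebra_simps)
  moreover have "line_reflection p u = (\<lambda>x. (p - L p) + x) \<circ> L"
    by (auto simp: line_reflection_def L_def fun_eq_iff algebra_simps)
  ultimately show ?thesis
    by (simp only: image_comp[symmetric] convex_hull_translation convex_hull_linear_image)
qed

text \<open>A reflection preserving the hull permutes the vertices isometrically, so it fixes each vertex
  when the sums of squared distances tell the vertices apart.\<close>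

lemma no_symmetry_axisI:
  assumes fin: "finite V" and ext: "\<And>v. v \<in> V \<Longrightarrow> v extreme_point_of (convex hull V)"
    and inj: "inj_on (\<lambda>v. \<Sum>w\<in>V. (dist v w)\<^sup>2) V" and nc: "\<not> collinear V"
  shows "\<not> has_symmetry_axis (convex hull V)"
proof
  assume "has_symmetry_axis (convex hull V)"
  then obtain p u where u: "norm u = 1" and "line_reflection p u ` (convex hull V) = convex hull V"
    unfolding has_symmetry_axis_def by blast
  define R where "R = line_reflection p u"
  have "convex hull (R ` V) = convex hull V"
    unfolding R_def convex_hull_line_reflection by fact
  \<comment> \<open>Each vertex is an extreme point of the hull of the image, hence a point of the
    image.\<close>
  then have "V \<subseteq> R ` V"
    using ext extreme_point_of_convex_hull by (metis subsetI)
  then have RV: "R ` V = V"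
    using fin by (metis card_image_le card_seteq finite_imageI)
  have iso: "dist (R x) (R y) = dist x y" for x y
    unfolding R_def by (rule dist_line_reflection[OF u])
  have "inj R"
    using iso by (metis dist_eq_0_iff injI)
  have fixed: "R v = v" if "v \<in> V" for v
  proof -
    have "(\<Sum>w\<in>V. (dist (R v) w)\<^sup>2) = (\<Sum>w\<in>R ` V. (dist (R v) w)\<^sup>2)" by (simp add: RV)
    also have "\<dots> = (\<Sum>w\<in>V. (dist v w)\<^sup>2)"
      using \<open>inj R\<close> by (subst sum.reindex) (auto simp: iso intro: inj_on_subset)
    finally show ?thesis
      by (rule inj_onD[OF inj]) (use that RV in auto)
  qed
  \<comment> \<open>Fixed points of a reflection lie on its axis, so all of \<open>V\<close> would
    be collinear.\<close>
  have on_line: "v = p + ((v - p) \<bullet> u) *\<^sub>R u" if "v \<in> V" for v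
  proof -
    define t where "t = (v - p) \<bullet> u"
    have "p + (2 * t) *\<^sub>R u - (v - p) = v"
      using fixed[OF that] by (simp add: R_def line_reflection_def t_def)
    then have "2 *\<^sub>R v = 2 *\<^sub>R (p + t *\<^sub>R u)"
      by (simp add: scaleR_2 scaleR_right_distrib algebra_simps)
    then show ?thesis by (simp add: t_def)
  qed
  have "collinear V"
    unfolding collinear_def
  proof (intro exI ballI)
    fix v w assume "v \<in> V" "w \<in> V"
    then have "v - w = (p + ((v - p) \<bullet> u) *\<^sub>R u) - (p + ((w - p) \<bullet> u) *\<^sub>R u)"
      using on_line[of v] on_line[of w] by (intro arg_cong2[of _ _ _ _ minus])
    also have "\<dots> = ((v - w) \<bullet> u) *\<^sub>R u"
      by (simp add: algebra_simps)
    finally show "v - w = ((v - w) \<bullet> u) *\<^sub>R u" .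
  qed
  with nc show False ..
qed

section \<open>Convex quadrilaterals\<close>

text \<open>The line with normal \<open>n\<close> supports the hull: it contains the affine hull of
  \<open>a\<close> and \<open>b\<close> and misses the hull of the other two vertices.\<close>

lemma closed_segment_edge_of_quadrilateral:
  fixes a b c d :: "'a::euclidean_space"
  assumes "a \<noteq> b" and n: "n \<bullet> a = \<beta>" "n \<bullet> b = \<beta>" "n \<bullet> c > \<beta>" "n \<bullet> d > \<beta>"
  shows "closed_segment a b edge_of convex hull {a, b, c, d}"
proof -
  have "affine hull {a, b} \<subseteq> {x. n \<bullet> x = \<beta>}"
    by (rule hull_minimal) (use n in \<open>auto simp: affine_hyperplane\<close>)
  moreover have "convex hull ({a, b, c, d} - {a, b}) \<subseteq> {x. n \<bullet> x > \<beta>}"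
    by (rule hull_minimal) (use n in \<open>auto simp: convex_halfspace_gt\<close>)
  ultimately have "convex hull {a, b} face_of convex hull {a, b, c, d}"
    by (intro face_of_convex_hulls) fastforce+
  then show ?thesis
    using \<open>a \<noteq> b\<close> by (simp add: edge_of_def segment_convex_hull aff_dim_convex_hull)
qed

definition cross2 :: "real^2 \<Rightarrow> real^2 \<Rightarrow> real" where
  "cross2 u v = u $ 1 * v $ 2 - u $ 2 * v $ 1"

lemma closed_segment_edge_of_left:
  assumes "0 < cross2 (b - a) (c - a)" "0 < cross2 (b - a) (d - a)"
  shows "closed_segment a b edge_of convex hull {a, b, c, d}"
proof (rule closed_segment_edge_of_quadrilateral)
  \<comment> \<open>A quarter turn of \<open>b - a\<close>: its inner product with
    \<open>x - a\<close> is \<open>cross2 (b - a) (x - a)\<close>.\<close>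
  let ?n = "vector [- (b - a) $ 2, (b - a) $ 1] :: real^2"
  show "a \<noteq> b" using assms by (auto simp: cross2_def)
  show "?n \<bullet> a = ?n \<bullet> a" ..
  show "?n \<bullet> b = ?n \<bullet> a" "?n \<bullet> c > ?n \<bullet> a" "?n \<bullet> d > ?n \<bullet> a"
    using assms by (simp_all add: inner_vec_def sum_2 cross2_def algebra_simps)
qed

text \<open>Each triple of consecutive vertices is counterclockwise. As signed area is invariant
  under cyclic shifts, the two other vertices lie strictly to the left of every side.\<close>

lemma convex_quadrilateralI:
  assumes "0 < cross2 (b - a) (c - a)" "0 < cross2 (c - b) (d - b)"
    and "0 < cross2 (d - c) (a - c)" "0 < cross2 (a - d) (b - d)"
  shows "convex_quadrilateral a b c d"
proof -
  have area: "cross2 (y - x) (z - x) = cross2 (z - y) (x - y)" for x y z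
    by (simp add: cross2_def algebra_simps)
  have perm: "{b, c, d, a} = {a, b, c, d}" "{c, d, a, b} = {a, b, c, d}" "{d, a, b, c} = {a, b, c, d}"
    by auto
  have e1: "closed_segment a b edge_of convex hull {a, b, c, d}"
    using assms area by (metis closed_segment_edge_of_left)
  have e2: "closed_segment b c edge_of convex hull {a, b, c, d}"
    using assms area perm by (metis closed_segment_edge_of_left)
  have e3: "closed_segment c d edge_of convex hull {a, b, c, d}"
    using assms area perm by (metis closed_segment_edge_of_left)
  have e4: "closed_segment d a edge_of convex hull {a, b, c, d}"
    using assms area perm by (metis closed_segment_edge_of_left)
  have ext: "x extreme_point_of S \<and> y extreme_point_of S" if "closed_segment x y edge_of S"
    for x y :: "real^2" and S
  proof -
    have "x extreme_point_of closed_segment x y" "y extreme_point_of closed_segment x y"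
      by (simp_all add: extreme_point_of_segment)
    then show ?thesis
      using that by (auto simp: edge_of_def extreme_point_of_face)
  qed
  have "distinct [a, b, c, d]"
    using assms by (auto simp: cross2_def)
  then show ?thesis
    unfolding convex_quadrilateral_def Let_def
    using e1 e2 e3 e4 ext[OF e1] ext[OF e3] by auto
qed

lemma collinear_iff_cross2: "collinear {0, u, v} \<longleftrightarrow> cross2 u v = 0"
proof
  assume "collinear {0, u, v}"
  then show "cross2 u v = 0" by (auto simp: collinear_lemma cross2_def)
next
  assume 0: "cross2 u v = 0"
  have "\<exists>c. v = c *\<^sub>R u" if "u \<noteq> 0"
  proof (cases "u $ 1 = 0")
    case True
    then have "u $ 2 \<noteq> 0" using that by (auto simp: vec_eq_iff forall_2)
    then show ?thesis using 0 True
      by (intro exI[of _ "v $ 2 / u $ 2"]) (auto simp: vec_eq_iff forall_2 cross2_def field_simps)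
  next
    case False
    then show ?thesis using 0
      by (intro exI[of _ "v $ 1 / u $ 1"]) (auto simp: vec_eq_iff forall_2 cross2_def field_simps)
  qed
  then show "collinear {0, u, v}" by (auto simp: collinear_lemma)
qed

text \<open>Only the sign changes under these swaps. This covers all labellings of the vertices when
  a parallelogram is excluded.\<close>

lemma cross2_nonzero_swap:
  assumes "cross2 (y - x) (w - z) \<noteq> 0"
  shows "cross2 (x - y) (w - z) \<noteq> 0" "cross2 (y - x) (z - w) \<noteq> 0" "cross2 (x - y) (z - w) \<noteq> 0"
    and "cross2 (w - z) (y - x) \<noteq> 0" "cross2 (w - z) (x - y) \<noteq> 0" "cross2 (z - w) (y - x) \<noteq> 0"
    and "cross2 (z - w) (x - y) \<noteq> 0"
  using assms by (simp_all add: cross2_def algebra_simps)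

section \<open>Choice of the shorter base\<close>

text \<open>Normalising \<open>\<lambda>\<close> to the total mass, Dziobek's equations read
  \<open>m\<^sub>i m\<^sub>j excess r\<^sub>i\<^sub>j = \<kappa> D\<^sub>i D\<^sub>j\<close>.\<close>

definition excess :: "real \<Rightarrow> real" where
  "excess r = 1 / r ^ 3 - 1"

lemma excess_antimono: "0 < r \<Longrightarrow> r \<le> s \<Longrightarrow> excess s \<le> excess r"
  by (simp add: excess_def frac_le power_mono)

text \<open>The radicand is chosen so that \<open>t * excess (diagonal s t) = - s * excess s\<close>. With bases
  \<open>s\<close> and \<open>t\<close>, equal masses at the ends of a leg force this on the diagonal issuing from the end
  of that leg on the base \<open>t\<close>.\<close>

definition diagonal :: "real \<Rightarrow> real \<Rightarrow> real" where
  "diagonal s t = root 3 (1 / (1 - (1 / s\<^sup>2 - s) / t))"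

text \<open>Here \<open>1 / s\<^sup>2 - s\<close> equals \<open>s * excess s\<close>, which is
  positive for \<open>s < 1\<close>; hence the negative sign, that is, a diagonal longer than
  1.\<close>

lemma diagonal_properties:
  assumes "0 < s" "s < 1" "0 < t" and den: "0 < 1 - (1 / s\<^sup>2 - s) / t"
  shows diagonal_pos: "0 < diagonal s t"
    and excess_diagonal: "t * excess (diagonal s t) = - s * excess s"
    and excess_diagonal_neg: "excess (diagonal s t) < 0"
proof -
  show "0 < diagonal s t"
    using den by (simp add: diagonal_def)
  have "excess (diagonal s t) = - ((1 / s\<^sup>2 - s) / t)"
    using den by (simp add: excess_def diagonal_def)
  then have "t * excess (diagonal s t) = s - 1 / s\<^sup>2"
    using assms by simp
  also have "\<dots> = - s * excess s"
    using assms by (simp add: excess_def field_simps power2_eq_square power3_eq_cube)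
  finally show eq: "t * excess (diagonal s t) = - s * excess s" .
  have "0 < excess s"
    using assms by (simp add: excess_def power_less_one_iff)
  then have "t * excess (diagonal s t) < 0"
    unfolding eq using assms by simp
  then show "excess (diagonal s t) < 0"
    using assms by (simp add: mult_less_0_iff)
qed

text \<open>With a rational bound \<open>k\<close> on the denominator, comparing a diagonal with a
  rational needs only a cube, no root.\<close>

lemma le_diagonalI:
  assumes "0 < 1 - (1 / s\<^sup>2 - s) / t" "1 - (1 / s\<^sup>2 - s) / t \<le> k" "k * r ^ 3 \<le> 1" "0 \<le> r"
  shows "r \<le> diagonal s t"
proof -
  have "(1 - (1 / s\<^sup>2 - s) / t) * r ^ 3 \<le> 1"
    using assms by (meson mult_right_mono order_trans zero_le_power)
  then have "r ^ 3 \<le> 1 / (1 - (1 / s\<^sup>2 - s) / t)"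
    using assms(1) by (simp add: pos_le_divide_eq mult.commute)
  then have "root 3 (r ^ 3) \<le> diagonal s t"
    unfolding diagonal_def by (intro real_root_le_mono) simp_all
  then show ?thesis by (simp add: odd_real_root_power_cancel)
qed

lemma diagonal_leI:
  assumes "0 < k" "k \<le> 1 - (1 / s\<^sup>2 - s) / t" "1 \<le> k * r ^ 3" "0 \<le> r"
  shows "diagonal s t \<le> r"
proof -
  have "1 \<le> (1 - (1 / s\<^sup>2 - s) / t) * r ^ 3"
    using assms by (meson mult_right_mono order_trans zero_le_power)
  then have "1 / (1 - (1 / s\<^sup>2 - s) / t) \<le> r ^ 3"
    using assms(1,2) by (simp add: pos_divide_le_eq mult.commute)
  then have "diagonal s t \<le> root 3 (r ^ 3)"
    unfolding diagonal_def by (intro real_root_le_mono) simp_all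
  then show ?thesis by (simp add: odd_real_root_power_cancel)
qed

text \<open>Squared legs of the trapezoid with bases \<open>9/10\<close>, \<open>b\<close> and the above diagonals.\<close>

definition left_sq :: "real \<Rightarrow> real" where
  "left_sq b = (9/10 * (diagonal b (9/10))\<^sup>2 + b * (diagonal (9/10) b)\<^sup>2) / (9/10 + b) - 9/10 * b"

definition right_sq :: "real \<Rightarrow> real" where
  "right_sq b = (b * (diagonal b (9/10))\<^sup>2 + 9/10 * (diagonal (9/10) b)\<^sup>2) / (9/10 + b) - 9/10 * b"

section \<open>Rational enclosures for the diagonals and legs\<close>

lemma inverse_square_bounds:
  assumes "17/20 \<le> (b::real)" "b \<le> 87/100"
  shows "1 / b\<^sup>2 \<le> 400/289" "10000/7569 \<le> 1 / b\<^sup>2"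
proof -
  have "(17/20)\<^sup>2 \<le> b\<^sup>2" "b\<^sup>2 \<le> (87/100)\<^sup>2"
    using assms by (intro power_mono; simp)+
  moreover have "0 < b\<^sup>2" using assms by simp
  ultimately show "1 / b\<^sup>2 \<le> 400/289" "10000/7569 \<le> 1 / b\<^sup>2"
    by (simp_all add: field_simps power2_eq_square)
qed

text \<open>Both expressions increase with \<open>b\<close>; the bounds are their values at the ends
  of the interval, rounded outwards.\<close>

lemma denominator_bounds:
  assumes b: "17/20 \<le> (b::real)" "b \<le> 87/100"
  shows "406/1000 \<le> 1 - (1 / b\<^sup>2 - b) / (9/10)" "1 - (1 / b\<^sup>2 - b) / (9/10) \<le> 499/1000"
    and "606/1000 \<le> 1 - (1 / (9/10)\<^sup>2 - 9/10) / b" "1 - (1 / (9/10)\<^sup>2 - 9/10) / b \<le> 616/1000"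
proof -
  have "1 - (1 / b\<^sup>2 - b) / (9/10) = 1 - 10/9 * (1 / b\<^sup>2) + 10/9 * b"
    by (simp add: diff_divide_distrib)
  then show "406/1000 \<le> 1 - (1 / b\<^sup>2 - b) / (9/10)" "1 - (1 / b\<^sup>2 - b) / (9/10) \<le> 499/1000"
    using inverse_square_bounds[OF b] b by linarith+
  have "1 / (9/10)\<^sup>2 - 9/10 = (271/810 :: real)"
    by (simp add: power2_eq_square)
  then show "606/1000 \<le> 1 - (1 / (9/10)\<^sup>2 - 9/10) / b" "1 - (1 / (9/10)\<^sup>2 - 9/10) / b \<le> 616/1000"
    using b by (simp_all add: field_simps)
qed

lemma diagonal_bounds:
  assumes b: "17/20 \<le> b" "b \<le> 87/100"
  shows "126/100 \<le> diagonal b (9/10)" "diagonal b (9/10) \<le> 136/100"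
    and "117/100 \<le> diagonal (9/10) b" "diagonal (9/10) b \<le> 119/100"
proof -
  note d = denominator_bounds[OF b]
  show "126/100 \<le> diagonal b (9/10)"
    by (rule le_diagonalI[OF less_le_trans[OF _ d(1)] d(2)]) (simp_all add: power3_eq_cube)
  show "diagonal b (9/10) \<le> 136/100"
    by (rule diagonal_leI[OF _ d(1)]) (simp_all add: power3_eq_cube)
  show "117/100 \<le> diagonal (9/10) b"
    by (rule le_diagonalI[OF less_le_trans[OF _ d(3)] d(4)]) (simp_all add: power3_eq_cube)
  show "diagonal (9/10) b \<le> 119/100"
    by (rule diagonal_leI[OF _ d(3)]) (simp_all add: power3_eq_cube)
qed

lemma diagonal_sq_bounds:
  assumes b: "17/20 \<le> b" "b \<le> 87/100"
  shows "15876/10000 \<le> (diagonal b (9/10))\<^sup>2" "(diagonal b (9/10))\<^sup>2 \<le> 18496/10000"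
    and "13689/10000 \<le> (diagonal (9/10) b)\<^sup>2" "(diagonal (9/10) b)\<^sup>2 \<le> 14161/10000"
proof -
  note d = diagonal_bounds[OF b]
  show "15876/10000 \<le> (diagonal b (9/10))\<^sup>2"
    using power_mono[OF d(1), of 2] by (simp add: power2_eq_square)
  show "(diagonal b (9/10))\<^sup>2 \<le> 18496/10000"
    using power_mono[OF d(2), of 2] d(1) by (simp add: power2_eq_square)
  show "13689/10000 \<le> (diagonal (9/10) b)\<^sup>2"
    using power_mono[OF d(3), of 2] by (simp add: power2_eq_square)
  show "(diagonal (9/10) b)\<^sup>2 \<le> 14161/10000"
    using power_mono[OF d(4), of 2] d(3) by (simp add: power2_eq_square)
qed

lemma weighted_mean_bounds:
  fixes b :: real
  assumes b: "17/20 \<le> b" "b \<le> 87/100"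
    and u: "15876/10000 \<le> u" "u \<le> 18496/10000" and v: "13689/10000 \<le> v" "v \<le> 14161/10000"
  shows "66/100 \<le> (9/10 * u + b * v) / (9/10 + b) - 9/10 * b"
    and "(9/10 * u + b * v) / (9/10 + b) - 9/10 * b < 1"
    and "66/100 \<le> (b * u + 9/10 * v) / (9/10 + b) - 9/10 * b"
    and "(b * u + 9/10 * v) / (9/10 + b) - 9/10 * b < 1"
proof -
  have bu: "17/20 * (15876/10000) \<le> b * u" "b * u \<le> 87/100 * (18496/10000)"
    using b u by (intro mult_mono; simp)+
  have bv: "17/20 * (13689/10000) \<le> b * v" "b * v \<le> 87/100 * (14161/10000)"
    using b v by (intro mult_mono; simp)+
  have "145/100 \<le> (9/10 * u + b * v) / (9/10 + b)" "(9/10 * u + b * v) / (9/10 + b) \<le> 17/10"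
    "145/100 \<le> (b * u + 9/10 * v) / (9/10 + b)" "(b * u + 9/10 * v) / (9/10 + b) \<le> 17/10"
    using b u v bu bv by (simp_all add: pos_le_divide_eq pos_divide_le_eq)
  then show "66/100 \<le> (9/10 * u + b * v) / (9/10 + b) - 9/10 * b"
    "(9/10 * u + b * v) / (9/10 + b) - 9/10 * b < 1"
    "66/100 \<le> (b * u + 9/10 * v) / (9/10 + b) - 9/10 * b"
    "(b * u + 9/10 * v) / (9/10 + b) - 9/10 * b < 1"
    using b by linarith+
qed

text \<open>Legs shorter than 1 have positive excess, as positive masses require. The lower bound
  later ensures a positive height.\<close>

lemma leg_sq_bounds:
  assumes b: "17/20 \<le> b" "b \<le> 87/100"
  shows "66/100 \<le> left_sq b" "left_sq b < 1" "66/100 \<le> right_sq b" "right_sq b < 1"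
  unfolding left_sq_def right_sq_def using weighted_mean_bounds[OF b diagonal_sq_bounds[OF b]] .

section \<open>The intermediate value argument for the shorter base\<close>

lemma continuous_on_leg_sq:
  "continuous_on {17/20..87/100} left_sq"
  "continuous_on {17/20..87/100} right_sq"
proof -
  let ?I = "{17/20..87/100::real}"
  have nz: "1 - (1 / b\<^sup>2 - b) / (9/10) \<noteq> 0" "1 - (1 / (9/10)\<^sup>2 - 9/10) / b \<noteq> 0"
      "b \<noteq> 0" "b\<^sup>2 \<noteq> 0" "9/10 + b \<noteq> 0" if "b \<in> ?I" for b
    using denominator_bounds[of b] that unfolding atLeastAtMost_iff zero_eq_power2 by linarith+
  have c1: "continuous_on ?I (\<lambda>b. diagonal b (9/10))"
    unfolding diagonal_def by (intro continuous_intros ballI) (erule nz | simp)+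
  have c2: "continuous_on ?I (\<lambda>b. diagonal (9/10) b)"
    unfolding diagonal_def by (intro continuous_intros ballI) (erule nz | simp)+
  show "continuous_on ?I left_sq" "continuous_on ?I right_sq"
    unfolding left_sq_def right_sq_def by (intro continuous_intros c1 c2 ballI; erule nz)+
qed

text \<open>At \<open>b = 17/20\<close> both legs are at least \<open>9/10\<close>, so their
  excesses are at most that of the longer base. At \<open>b = 87/100\<close> both legs are at most
  \<open>b\<close>, so their excesses are at least that of the shorter base. The difference of
  products thus changes sign.\<close>

lemma exists_balanced_base:
  "\<exists>b. 17/20 \<le> b \<and> b \<le> 87/100 \<and>
     excess (9/10) * excess b = excess (sqrt (left_sq b)) * excess (sqrt (right_sq b))"
proof -
  let ?F = "\<lambda>b. excess (sqrt (left_sq b)) * excess (sqrt (right_sq b))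
              - excess (9/10) * excess b"
  have sq: "0 < left_sq b" "0 < right_sq b" if "17/20 \<le> b" "b \<le> 87/100" for b
    using leg_sq_bounds[OF that] by auto
  have "continuous_on {17/20..87/100} ?F"
    unfolding excess_def
    by (intro continuous_intros continuous_on_leg_sq ballI)
      (use sq in \<open>auto simp: less_imp_neq[symmetric]\<close>)
  moreover have "?F (17/20) \<le> 0"
  proof -
    \<comment> \<open>At an endpoint the denominator is an explicit rational and serves as
      \<open>k\<close> itself.\<close>
    have d: "133/100 \<le> diagonal (17/20) (9/10)" "118/100 \<le> diagonal (9/10) (17/20)"
      by (rule le_diagonalI[OF _ order_refl]; simp add: power2_eq_square power3_eq_cube)+
    have d2: "17689/10000 \<le> (diagonal (17/20) (9/10))\<^sup>2" "13924/10000 \<le> (diagonal (9/10) (17/20))\<^sup>2"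
      using power_mono[OF d(1), of 2] power_mono[OF d(2), of 2] by (simp_all add: power2_eq_square)
    have "(9/10)\<^sup>2 \<le> left_sq (17/20)" "(9/10)\<^sup>2 \<le> right_sq (17/20)"
      using d2 by (simp_all add: left_sq_def right_sq_def add_divide_distrib power_divide)
    then have c: "9/10 \<le> sqrt (left_sq (17/20))" "9/10 \<le> sqrt (right_sq (17/20))"
      using real_le_rsqrt by blast+
    have "excess (sqrt (left_sq (17/20))) * excess (sqrt (right_sq (17/20)))
        \<le> excess (9/10) * excess (9/10)"
    proof (rule mult_mono)
      show "0 \<le> excess (9/10)" by (simp add: excess_def power3_eq_cube)
      have "excess 1 \<le> excess (sqrt (right_sq (17/20)))"
        using leg_sq_bounds[of "17/20"] by (intro excess_antimono) auto
      then show "0 \<le> excess (sqrt (right_sq (17/20)))" by (simp add: excess_def)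
    qed (use c in \<open>auto intro!: excess_antimono\<close>)
    also have "\<dots> \<le> excess (9/10) * excess (17/20)"
      by (simp add: excess_def power3_eq_cube)
    finally show ?thesis by simp
  qed
  moreover have "0 \<le> ?F (87/100)"
  proof -
    have d: "diagonal (87/100) (9/10) \<le> 127/100" "diagonal (9/10) (87/100) \<le> 118/100"
      by (rule diagonal_leI[OF _ order_refl]; simp add: power2_eq_square power3_eq_cube)+
    have d2: "(diagonal (87/100) (9/10))\<^sup>2 \<le> 16129/10000" "(diagonal (9/10) (87/100))\<^sup>2 \<le> 13924/10000"
      using power_mono[OF d(1), of 2] power_mono[OF d(2), of 2] diagonal_bounds[of "87/100"]
      by (simp_all add: power2_eq_square)
    have "left_sq (87/100) \<le> (87/100)\<^sup>2" "right_sq (87/100) \<le> (87/100)\<^sup>2"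
      using d2 by (simp_all add: left_sq_def right_sq_def add_divide_distrib power_divide)
    then have c: "sqrt (left_sq (87/100)) \<le> 87/100" "sqrt (right_sq (87/100)) \<le> 87/100"
      by (intro real_le_lsqrt; simp)+
    have "excess (9/10) * excess (87/100) \<le> excess (87/100) * excess (87/100)"
      by (simp add: excess_def power3_eq_cube)
    also have "\<dots> \<le> excess (sqrt (left_sq (87/100))) * excess (sqrt (right_sq (87/100)))"
    proof (rule mult_mono)
      show "0 \<le> excess (87/100)" by (simp add: excess_def power3_eq_cube)
      have "excess (87/100) \<le> excess (sqrt (left_sq (87/100)))"
        using c sq[of "87/100"] by (auto intro!: excess_antimono)
      with \<open>0 \<le> excess (87/100)\<close> show "0 \<le> excess (sqrt (left_sq (87/100)))" by simp
    qed (use c sq[of "87/100"] in \<open>auto intro!: excess_antimono\<close>)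
    finally show ?thesis by simp
  qed
  ultimately obtain b where "17/20 \<le> b" "b \<le> 87/100" "?F b = 0"
    using IVT'[of ?F "17/20" 0 "87/100"] by auto
  then show ?thesis by (intro exI[of _ b]) simp
qed

section \<open>The configuration\<close>

lemma norm_real2_eq: "0 \<le> r \<Longrightarrow> (v $ 1)\<^sup>2 + (v $ 2)\<^sup>2 = r\<^sup>2 \<Longrightarrow> norm (v :: real^2) = r"
  by (simp add: norm_vec_def L2_set_def sum_2)

text \<open>\<open>f\<close> and \<open>g\<close> are the diagonals, \<open>c\<close> and
  \<open>e\<close> the legs. Eliminating the coordinates gives the equations for \<open>c\<close>
  and \<open>e\<close>; \<open>height\<close> makes the trapezoid exist, \<open>diff\<close>
  separates its vertices metrically, and \<open>sgn\<close> makes the masses positive.\<close>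

lemma trapezoid_with_equal_masses:
  fixes a b c e f g :: real
  assumes ab: "0 < b" "b < a" and pos: "0 < c" "0 < e" "0 < f" "0 < g"
    and c: "c\<^sup>2 = (a * f\<^sup>2 + b * g\<^sup>2) / (a + b) - a * b"
    and e: "e\<^sup>2 = (b * f\<^sup>2 + a * g\<^sup>2) / (a + b) - a * b"
    and diff: "a\<^sup>2 - b\<^sup>2 < f\<^sup>2 - g\<^sup>2" "f\<^sup>2 - g\<^sup>2 < (a + b)\<^sup>2"
    and height: "(((f\<^sup>2 - g\<^sup>2) / (a + b) + a - b) / 2)\<^sup>2 < c\<^sup>2"
    and S: "a * excess f = - b * excess b" "b * excess g = - a * excess a"
      "excess a * excess b = excess c * excess e"
    and sgn: "0 < excess c" "0 < excess e" "excess f < 0"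
  shows "\<exists>(m :: 4 \<Rightarrow> real) (q :: 4 \<Rightarrow> real^2).
           (\<forall>k. 0 < m k) \<and> trapezoid_central_configuration m q \<and> non_symmetric q \<and>
           (\<exists>i j. i \<noteq> j \<and> m i = m j)"
proof -
  \<comment> \<open>Subtracting the squared diagonals cancels the height and leaves
    \<open>(a + b) * (2 * x + b - a)\<close>, which determines \<open>x\<close>.\<close>
  define d where "d = (f\<^sup>2 - g\<^sup>2) / (a + b)"
  define x where "x = (d + a - b) / 2"
  define h where "h = sqrt (c\<^sup>2 - x\<^sup>2)"
  have a: "0 < a" and ab': "0 < a + b" using ab by auto
  have h: "0 < h" and h2: "h\<^sup>2 = c\<^sup>2 - x\<^sup>2"
    using height by (simp_all add: h_def x_def d_def)
  have g2: "g\<^sup>2 = f\<^sup>2 - d * (a + b)"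
    using ab' by (simp add: d_def)
  have c2: "c\<^sup>2 = f\<^sup>2 - b * d - a * b" and e2: "e\<^sup>2 = f\<^sup>2 - a * d - a * b"
    unfolding c e d_def using ab' by (simp_all add: field_simps)
  have x2: "d = 2 * x - a + b" by (simp add: x_def field_simps)
  have "(a - b) * (a + b) < d * (a + b)" "d * (a + b) < (a + b) * (a + b)"
    using diff g2 by (simp_all add: algebra_simps power2_eq_square)
  then have d: "a - b < d" "d < a + b"
    using ab' by simp_all

  define p1 p2 p3 p4 :: "real^2" where
    "p1 = vector [0, 0]" and "p2 = vector [a, 0]" and "p3 = vector [x + b, h]" and "p4 = vector [x, h]"
  note p = p1_def p2_def p3_def p4_def
  define V where "V = {p1, p2, p3, p4}"
  have r: "norm (p1 - p2) = a" "norm (p3 - p4) = b" "norm (p1 - p3) = f" "norm (p2 - p4) = g"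
      "norm (p1 - p4) = c" "norm (p2 - p3) = e"
    by (rule norm_real2_eq;
        use a ab pos in \<open>simp add: p g2 c2 e2 h2 x2; simp add: algebra_simps power2_eq_square\<close>)+
  have "norm (p2 - p1) = a" "norm (p4 - p3) = b" "norm (p3 - p1) = f" "norm (p4 - p2) = g"
      "norm (p4 - p1) = c" "norm (p3 - p2) = e"
    using r by (simp_all add: norm_minus_commute)
  note r' = r this
  have neq: "distinct [p1, p2, p3, p4]"
    using r a ab pos by auto

  have quad: "convex_quadrilateral p1 p2 p3 p4"
    using a ab h by (intro convex_quadrilateralI) (simp_all add: p cross2_def algebra_simps)
  have "trapezoid V"
    unfolding trapezoid_def V_def using quad
    by (intro exI[of _ p1] exI[of _ p2] exI[of _ p3] exI[of _ p4])
      (simp add: parallel_sides_def collinear_iff_cross2, simp add: p cross2_def)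
  have "\<not> parallelogram V"
  proof
    assume "parallelogram V"
    then obtain A B C D where eq: "V = {A, B, C, D}" and "convex_quadrilateral A B C D"
      and par: "parallel_sides A B C D" "parallel_sides B C D A"
      unfolding parallelogram_def by blast
    then have dist: "distinct [A, B, C, D]"
      by (simp only: convex_quadrilateral_def)
    note par' = par[unfolded parallel_sides_def collinear_iff_cross2]
    have cases: "A \<in> V" "B \<in> V" "C \<in> V" "D \<in> V" using eq by auto
    \<comment> \<open>Of the three splittings of the vertices into two pairs, these two give
      non-parallel lines. The sides of a parallelogram use two splittings, hence one of
      these.\<close>
    have "cross2 (p3 - p1) (p4 - p2) \<noteq> 0" "cross2 (p4 - p1) (p3 - p2) \<noteq> 0"
      using ab mult_pos_pos[OF ab' h] h by (simp_all add: p cross2_def algebra_simps)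
    note nz = this[THEN cross2_nonzero_swap(1)] this[THEN cross2_nonzero_swap(2)]
      this[THEN cross2_nonzero_swap(3)] this[THEN cross2_nonzero_swap(4)]
      this[THEN cross2_nonzero_swap(5)] this[THEN cross2_nonzero_swap(6)]
      this[THEN cross2_nonzero_swap(7)] this
    show False
      using cases dist par' unfolding V_def by (elim insertE emptyE) (simp_all add: nz)
  qed
  have "\<not> has_symmetry_axis (convex hull V)"
  proof (rule no_symmetry_axisI)
    show "finite V" by (simp add: V_def)
    show "v extreme_point_of convex hull V" if "v \<in> V" for v
      using quad that unfolding convex_quadrilateral_def V_def Let_def by blast
    have sum: "(\<Sum>w\<in>V. (dist v w)\<^sup>2)
        = (dist v p1)\<^sup>2 + (dist v p2)\<^sup>2 + (dist v p3)\<^sup>2 + (dist v p4)\<^sup>2" for v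
      unfolding V_def using neq by simp
    \<comment> \<open>These products are the successive differences of the sums of squared
      distances, which decrease in the order \<open>p1\<close>, \<open>p3\<close>,
      \<open>p2\<close>, \<open>p4\<close>.\<close>
    have "0 < (a - b) * (d + (a + b))" "0 < (d - (a - b)) * (a + b)" "0 < (a - b) * ((a + b) - d)"
      using ab d by (intro mult_pos_pos; simp)+
    then have "c\<^sup>2 + a\<^sup>2 + f\<^sup>2 > b\<^sup>2 + e\<^sup>2 + f\<^sup>2" "b\<^sup>2 + e\<^sup>2 + f\<^sup>2 > a\<^sup>2 + e\<^sup>2 + g\<^sup>2"
      "a\<^sup>2 + e\<^sup>2 + g\<^sup>2 > b\<^sup>2 + c\<^sup>2 + g\<^sup>2"
      unfolding c2 e2 g2 by (simp_all add: algebra_simps power2_eq_square)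
    then show "inj_on (\<lambda>v. \<Sum>w\<in>V. (dist v w)\<^sup>2) V"
      unfolding sum unfolding dist_norm V_def inj_on_def by (auto simp: r')
    show "\<not> collinear V"
    proof
      assume "collinear V"
      then have "collinear {p2, p1, p4}" by (rule collinear_subset) (auto simp: V_def)
      then have "cross2 (p2 - p1) (p4 - p1) = 0"
        by (simp add: collinear_3[of p2 p1 p4] collinear_iff_cross2)
      then show False using a h by (simp add: p cross2_def)
    qed
  qed

  define q :: "4 \<Rightarrow> real^2" where
    "q = (\<lambda>k. if k = 1 then p1 else if k = 2 then p2 else if k = 3 then p3 else p4)"
  \<comment> \<open>With \<open>m 1 = m 4 = 1\<close>, the pair 1, 4 forces \<kappa> to be
    \<open>- excess c / (a * b)\<close>; the pairs 1, 3 and 2, 3 then give \<open>m 3\<close> and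
    \<open>m 2\<close>.\<close>
  define m :: "4 \<Rightarrow> real" where
    "m = (\<lambda>k. if k = 2 then - excess f / excess e else if k = 3 then - excess c / excess f else 1)"
  define D :: "4 \<Rightarrow> real" where
    "D = (\<lambda>k. if k = 1 then b else if k = 2 then - b else if k = 3 then a else - a)"
  have q: "q 1 = p1" "q 2 = p2" "q 3 = p3" "q 4 = p4" by (simp_all add: q_def)
  have m: "m 1 = 1" "m 2 = - excess f / excess e" "m 3 = - excess c / excess f" "m 4 = 1"
    by (simp_all add: m_def)
  have D: "D 1 = b" "D 2 = - b" "D 3 = a" "D 4 = - a" by (simp_all add: D_def)
  have range: "range q = V"
    unfolding UNIV_4 V_def by (simp add: q)
  have mpos: "0 < m k" for k
    using sgn by (simp add: m_def divide_neg_pos divide_pos_neg)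
  have "central_configuration m q"
  proof (rule central_configurationI_Dziobek)
    show "inj q"
      unfolding inj_def forall_4 using neq by (auto simp: q)
    show "0 < (1::real)" by simp
    show "(\<Sum>k\<in>UNIV. D k) = 0" by (simp add: sum_4 D)
    show "(\<Sum>k\<in>UNIV. D k *\<^sub>R q k) = 0"
      by (simp add: sum_4 D q p vec_eq_iff forall_2 algebra_simps)
    have ef: "excess f * excess g = excess c * excess e"
    proof -
      have "(a * excess f) * (b * excess g) = a * b * (excess a * excess b)"
        unfolding S(1,2) by simp
      then show ?thesis using a ab by (simp add: S(3))
    qed
    have ea: "excess a = - b * excess g / a" and eb: "excess b = - a * excess f / b"
      using S(1,2) a ab by (simp_all add: field_simps)
    have "\<forall>i j. i \<noteq> j \<longrightarrow> m i * m j * excess (norm (q i - q j)) = - excess c / (a * b) * D i * D j"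
      unfolding forall_4 using sgn a ab ef
      by (simp add: m q D r') (simp add: ea eb field_simps)
    then show "m i * m j * (1 / norm (q i - q j) ^ 3 - 1) = - excess c / (a * b) * D i * D j"
      if "i \<noteq> j" for i j
      using that unfolding excess_def by blast
  qed (rule mpos)
  moreover have "(1::4) \<noteq> 4" "m 1 = m 4" by (simp_all add: m)
  ultimately show ?thesis
    using mpos \<open>trapezoid V\<close> \<open>\<not> parallelogram V\<close> \<open>\<not> has_symmetry_axis (convex hull V)\<close>
    unfolding trapezoid_central_configuration_def non_symmetric_def range[symmetric] by blast
qed

theorem mainTheorem3:
  shows "\<exists>(m :: 4 \<Rightarrow> real) (q :: 4 \<Rightarrow> real^2).
           (\<forall>k. 0 < m k) \<and> trapezoid_central_configuration m q \<and> non_symmetric q \<and>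
           (\<exists>i j. i \<noteq> j \<and> m i = m j)"
proof -
  obtain b where b: "17/20 \<le> b" "b \<le> 87/100"
    and bal: "excess (9/10) * excess b
      = excess (sqrt (left_sq b)) * excess (sqrt (right_sq b))"
    using exists_balanced_base by blast
  note dn = denominator_bounds[OF b] and ds = diagonal_sq_bounds[OF b] and l = leg_sq_bounds[OF b]
  let ?f = "diagonal b (9/10)" and ?g = "diagonal (9/10) b"
  have f: "0 < ?f" "9/10 * excess ?f = - b * excess b" "excess ?f < 0"
    using diagonal_properties[OF _ _ _ less_le_trans[OF _ dn(1)]] b by simp_all
  have g: "0 < ?g" "b * excess ?g = - (9/10) * excess (9/10)"
    using diagonal_properties[OF _ _ _ less_le_trans[OF _ dn(3)]] b by simp_all
  have ex: "0 < excess r" if "0 < r" "r < 1" for r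
    using that by (simp add: excess_def power_less_one_iff)
  have b2: "(17/20)\<^sup>2 \<le> b\<^sup>2" using b by (intro power_mono) auto
  \<comment> \<open>The abscissa of the fourth vertex is \<open>(t + 9/10 - b) / 2\<close>. Its
    square is at most \<open>1/4\<close>, below the bound \<open>66/100\<close> for the squared left
    leg.\<close>
  define t where "t = (?f\<^sup>2 - ?g\<^sup>2) / (9/10 + b)"
  have "0 \<le> t"
    unfolding t_def using ds b by (intro divide_nonneg_nonneg) auto
  moreover have "t \<le> (1/2) / (7/4)"
    unfolding t_def using ds b by (intro frac_le) auto
  ultimately have "((t + 9/10 - b) / 2)\<^sup>2 \<le> (1/2)\<^sup>2"
    using b by (intro power_mono) auto
  then have height: "(((?f\<^sup>2 - ?g\<^sup>2) / (9/10 + b) + 9/10 - b) / 2)\<^sup>2 < (sqrt (left_sq b))\<^sup>2"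
    using l by (simp add: t_def power_divide)
  have "(7/4)\<^sup>2 \<le> (9/10 + b)\<^sup>2" using b by (intro power_mono) auto
  then have diff: "(9/10)\<^sup>2 - b\<^sup>2 < ?f\<^sup>2 - ?g\<^sup>2" "?f\<^sup>2 - ?g\<^sup>2 < (9/10 + b)\<^sup>2"
    using ds b2 by (simp_all add: power_divide)
  have sq: "(sqrt (left_sq b))\<^sup>2 = left_sq b" "(sqrt (right_sq b))\<^sup>2 = right_sq b"
    using l by simp_all
  show ?thesis
  proof (rule trapezoid_with_equal_masses[OF _ _ _ _ f(1) g(1) trans[OF sq(1) left_sq_def]
        trans[OF sq(2) right_sq_def] diff height f(2) g(2) bal _ _ f(3)])
    show "0 < excess (sqrt (left_sq b))" "0 < excess (sqrt (right_sq b))"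
      using l by (auto intro!: ex)
  qed (use b l in auto)
qed

end
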